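(* Let $\mathfrak{g}$ be an $n$-dimensional nilpotent Lie algebra over a field $\mathbb{K}$ of characteristic $0$. Then $b(\mathfrak{g})=2$ if and only if one of the following conditions is satisfied: (1) $\mathfrak{g}$ is $2$-step nilpotent with characteristic sequence $c(\mathfrak{g})=(2,2,1,\dots,1)$; (2) $\mathfrak{g}$ is $3$-step nilpotent with characteristic sequence $c(\mathfrak{g})=(3,1,\dots,1)$.
   Context: Breadth: $b(\mathfrak{g})=\max\{\operatorname{rank}(\operatorname{ad} X)\;:\; X\in\mathfrak{g}\}$. Characteristic sequence: let $\mathfrak{g}$ be a finite-dimensional nilpotent Lie algebra and $\mathcal{C}^1(\mathfrak{g})=[\mathfrak{g},\mathfrak{g}]$ its derived subalgebra. For $X\in\mathfrak{g}$ let $c(X)$ be the sequence, in decreasing order, of the dimensions of the Jordan blocks of the nilpotent operator $\operatorname{ad}X$. Then $c(\mathfrak{g})=\max\{c(X): X\in\mathfrak{g}\setminus\mathcal{C}^1(\mathfrak{g})\}$, the maximum being taken for the lexicographic order. The entries of $c(\mathfrak{g})$ sum to $n=\dim\mathfrak{g}$ and the last one is $1$. "$k$-step nilpotent" means nilpotent of nilpotency class exactly $k$. *)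

theory Defs
  imports
    "HOL.Vector_Spaces"
    "HOL-Library.List_Lexorder"
    "Jordan_Normal_Form.Jordan_Normal_Form"
begin

locale lie_algebra = vector_space scale
  for scale :: "'k::field \<Rightarrow> 'g::ab_group_add \<Rightarrow> 'g" (infixr \<open>*s\<close> 75) +
  fixes bracket :: "'g \<Rightarrow> 'g \<Rightarrow> 'g"
  assumes bracket_add_left: "bracket (x + y) z = bracket x z + bracket y z"
    and bracket_add_right: "bracket x (y + z) = bracket x y + bracket x z"
    and bracket_scale_left: "bracket (a *s x) y = a *s bracket x y"
    and bracket_scale_right: "bracket x (a *s y) = a *s bracket x y"
    and bracket_self: "bracket x x = 0"
    and jacobi: "bracket x (bracket y z) + bracket y (bracket z x) + bracket z (bracket x y) = 0"
begin

definition ad :: "'g \<Rightarrow> 'g \<Rightarrow> 'g" where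
  "ad x = (\<lambda>y. bracket x y)"

definition bracket_space :: "'g set \<Rightarrow> 'g set \<Rightarrow> 'g set" where
  "bracket_space U V = span {bracket x y | x y. x \<in> U \<and> y \<in> V}"

text \<open>Indexed so that term 0 is the whole algebra and term 1 the derived subalgebra.\<close>

primrec lower_central :: "nat \<Rightarrow> 'g set" where
  "lower_central 0 = UNIV"
| "lower_central (Suc k) = bracket_space UNIV (lower_central k)"

definition nilpotent :: bool where
  "nilpotent \<longleftrightarrow> (\<exists>k. lower_central k = {0})"

text \<open>Nilpotent of class exactly \<open>k\<close>.\<close>

definition step_nilpotent :: "nat \<Rightarrow> bool" where
  "step_nilpotent k \<longleftrightarrow> lower_central k = {0} \<and> (\<forall>j<k. lower_central j \<noteq> {0})"

definition derived_subalgebra :: "'g set" where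
  "derived_subalgebra = bracket_space UNIV UNIV"

definition linear_rank :: "('g \<Rightarrow> 'g) \<Rightarrow> nat" where
  "linear_rank f = dim (range f)"

text \<open>In finite dimension the set of ranks is finite and nonempty, so \<open>Max\<close> is attained.\<close>

definition breadth :: nat where
  "breadth = Max (range (\<lambda>x. linear_rank (ad x)))"

definition ordered_basis :: "'g list \<Rightarrow> bool" where
  "ordered_basis bs \<longleftrightarrow> distinct bs \<and> independent (set bs) \<and> span (set bs) = UNIV"

text \<open>\<open>A\<close> is the matrix of the endomorphism \<open>f\<close> in the basis \<open>bs\<close>: its column \<open>j\<close> holds the
  coordinates of the image of the \<open>j\<close>-th basis vector.\<close>

definition is_matrix_of :: "'g list \<Rightarrow> ('g \<Rightarrow> 'g) \<Rightarrow> 'k mat \<Rightarrow> bool" where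
  "is_matrix_of bs f A \<longleftrightarrow> A \<in> carrier_mat (length bs) (length bs) \<and>
     (\<forall>j<length bs. f (bs ! j) = (\<Sum>i<length bs. (A $$ (i, j)) *s (bs ! i)))"

text \<open>The list of sizes of the Jordan blocks of a nilpotent endomorphism of a finite-dimensional
  space; all blocks are nonempty and belong to the eigenvalue 0.\<close>

definition nilpotent_jordan_sizes :: "('g \<Rightarrow> 'g) \<Rightarrow> nat list \<Rightarrow> bool" where
  "nilpotent_jordan_sizes f ns \<longleftrightarrow> 0 \<notin> set ns \<and>
     (\<exists>bs. ordered_basis bs \<and> is_matrix_of bs f (jordan_matrix (map (\<lambda>d. (d, 0)) ns)))"

text \<open>The decreasing list of block sizes is unique by the Jordan normal form theorem; it exists
  whenever \<open>ad x\<close> is nilpotent and the algebra is finite-dimensional.\<close>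

definition char_seq_of :: "'g \<Rightarrow> nat list" where
  "char_seq_of x = (THE ns. sorted_wrt (\<ge>) ns \<and> nilpotent_jordan_sizes (ad x) ns)"

text \<open>The order on \<open>nat list\<close> is the lexicographic one. All sequences involved are partitions of
  the dimension, so the maximum ranges over a finite set; that set is empty only in dimension 0.\<close>

definition char_seq :: "nat list" where
  "char_seq = Max (char_seq_of ` (UNIV - derived_subalgebra))"

end

end

theory Submission
  imports Defs
begin

text \<open>
  A nilpotent operator with Jordan block sizes \<open>d\<close> has rank equal to the sum of the \<open>d - 1\<close>, and
  its square vanishes iff all blocks have size at most 2. Hence the operators of rank 2 are exactly
  those with sizes \<open>(2, 2, 1, \<dots>, 1)\<close> or \<open>(3, 1, \<dots>, 1)\<close>, and the square of the operator tells the
  two apart. The theorem compares the rank of all \<open>ad x\<close> with the lexicographically largest list of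
  sizes, and identifies the nilpotency class.

  From breadth 2 to the class. If \<open>[x, [x, y]] = 0\<close> for all \<open>x\<close> and \<open>y\<close>, then polarisation and the
  Jacobi identity give \<open>3 [x, [y, z]] = 0\<close>, so the class is at most 2. This works modulo any
  subspace (\<open>lower_central_2_subset_if_engel\<close>). In general, let \<open>(ad x)\<^sup>2 y\<close> lie outside
  the fourth term \<open>L = [g, [g, [g, g]]]\<close> of the lower central series. As \<open>ad x\<close> has rank at most
  2, its image is spanned by \<open>[x, y]\<close> and \<open>[x, [x, y]]\<close> and meets \<open>L\<close> trivially; so \<open>x\<close> commutes
  with \<open>[g, [g, g]]\<close>, which it maps into \<open>L\<close>. Enough such \<open>x\<close> exist to give \<open>L = 0\<close>
  (\<open>lower_central_3_trivial_if_rank_le_2\<close>). The two cases of the theorem are now those where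
  \<open>(ad x)\<^sup>2\<close> vanishes for all \<open>x\<close> outside the derived subalgebra, or not.

  From the characteristic sequence to breadth 2. For \<open>(2, 2, 1, \<dots>, 1)\<close> in class 2 all squares
  vanish, and among lists with entries at most 2 the lexicographic order is that of rank. For
  \<open>(3, 1, \<dots>, 1)\<close> the order does not bound the rank of elements with vanishing square, such as
  those with sizes \<open>(2, 2, 2)\<close>. Adding a multiple of one such element \<open>y\<close> to an element \<open>x\<close> with
  \<open>(ad x)\<^sup>2 \<noteq> 0\<close> repairs this: for all but finitely many \<open>t\<close> the rank of \<open>ad (x + t y)\<close> is at
  least that of \<open>ad y\<close> (\<open>rank_pencil_ge_cofinite\<close>), which would produce a list of sizes larger
  than \<open>(3, 1, \<dots>, 1)\<close>.

  Apart from that rank bound, arguments about generic elements take the form of interpolation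
  (\<open>quadratic_interpolation\<close>): a vector that depends quadratically on \<open>t\<close> and lies in a subspace for
  \<open>t = 1, -1, 2\<close> lies in it for \<open>t = 0\<close>. That the characteristic sequence is well defined rests on
  the existence of Jordan chains for a nilpotent operator over an arbitrary field
  (\<open>nilpotent_operator.ex_jordan_chains\<close>) and on the ranks of its powers
  (\<open>rank_power_jordan_sizes\<close>).
\<close>

section \<open>Partitions and the lexicographic order\<close>

text \<open>For a nilpotent operator with block sizes \<open>ns\<close> the sum of all \<open>d - k\<close> is the rank of its
\<open>k\<close>-th power. Its first differences count the parts larger than \<open>k\<close>, so the ranks of all powers
determine the partition.\<close>

lemma partition_eqI:
  fixes ns ms :: "nat list"
  assumes ns: "sorted_wrt (\<ge>) ns" "0 \<notin> set ns" and ms: "sorted_wrt (\<ge>) ms" "0 \<notin> set ms"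
    and eq: "\<And>k. (\<Sum>d\<leftarrow>ns. d - k) = (\<Sum>d\<leftarrow>ms. d - k)"
  shows "ns = ms"
proof -
  have count: "length (filter ((<) k) xs) + (\<Sum>d\<leftarrow>xs. d - Suc k) = (\<Sum>d\<leftarrow>xs. d - k)" for k and xs :: "nat list"
    by (induction xs) auto
  have gt: "length (filter ((<) k) ns) = length (filter ((<) k) ms)" for k
    using count[of k ns] count[of k ms] eq[of k] eq[of "Suc k"] by simp
  have cnt: "count (mset xs) (Suc k) + length (filter ((<) (Suc k)) xs) = length (filter ((<) k) xs)"
    for k and xs :: "nat list"
    by (induction xs) auto
  have "count (mset ns) d = count (mset ms) d" for d
  proof (cases d)
    case 0
    then show ?thesis using ns(2) ms(2) by (simp add: count_eq_zero_iff[THEN iffD2])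
  next
    case (Suc k)
    then show ?thesis using cnt[of ns k] cnt[of ms k] gt by simp
  qed
  then have "mset ns = mset ms" by (rule multiset_eqI)
  then have "mset (rev ns) = mset (rev ms)" by simp
  moreover have "sorted (rev ns)" "sorted (rev ms)" using ns(1) ms(1) by (simp_all add: sorted_wrt_rev)
  ultimately have "rev ns = rev ms" by (metis properties_for_sort)
  then show ?thesis by simp
qed

text \<open>The sum of all \<open>d - 1\<close>, called the defect of a partition, is the rank of a nilpotent operator
with these block sizes; breadth two means that the largest defect to occur is 2.\<close>

lemma defect_Cons: "(\<Sum>d\<leftarrow>x # xs. d - (1::nat)) = (x - 1) + (\<Sum>d\<leftarrow>xs. d - 1)"
  by simp

lemma defect_eq_0_iff: "(\<Sum>d\<leftarrow>ns. d - (1::nat)) = 0 \<longleftrightarrow> (\<forall>d\<in>set ns. d \<le> 1)"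
  by (induction ns) auto

lemma partition_defect_0:
  fixes ns :: "nat list"
  assumes "0 \<notin> set ns" "(\<Sum>d\<leftarrow>ns. d - 1) = 0"
  shows "replicate (sum_list ns) 1 = ns"
  using assms
proof (induction ns)
  case (Cons d ns)
  have "(\<Sum>d\<leftarrow>ns. d - 1) = 0" "d - 1 = 0" using Cons.prems(2) unfolding defect_Cons by linarith+
  then have "d = 1" "replicate (sum_list ns) 1 = ns" using Cons by auto
  then show ?case by simp
qed simp

lemma partition_le_ones:
  fixes ns :: "nat list"
  assumes "sorted_wrt (\<ge>) ns" "ns \<le> replicate m 1"
  shows "(\<Sum>d\<leftarrow>ns. d - 1) = 0"
proof (cases ns)
  case (Cons y ys)
  then have "y \<le> 1" using assms(2) by (cases m) auto
  then show ?thesis unfolding defect_eq_0_iff using assms(1) Cons by auto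
qed simp

lemma partition_parts_le_2_cases:
  fixes ns :: "nat list"
  assumes ns: "sorted_wrt (\<ge>) ns" "0 \<notin> set ns" "\<forall>d\<in>set ns. d \<le> 2"
  obtains (small) "(\<Sum>d\<leftarrow>ns. d - 1) \<le> 1" "ns < [2, 2]"
    | (twos) zs where "ns = 2 # 2 # zs"
proof (cases ns)
  case Nil
  then show ?thesis using small by simp
next
  case (Cons x xs)
  show ?thesis
  proof (cases xs)
    case Nil
    then show ?thesis using small[unfolded Cons \<open>ns = x # xs\<close>] ns Cons \<open>ns = x # xs\<close> by (cases "x = 2") auto
  next
    case (Cons y zs)
    show ?thesis
    proof (cases "y = 2")
      case True
      then have "x = 2" using ns Cons \<open>ns = x # xs\<close> by auto
      then show ?thesis using twos True Cons \<open>ns = x # xs\<close> by simp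
    next
      case False
      then have y: "y \<le> 1" using ns Cons \<open>ns = x # xs\<close> by auto
      then have "(\<Sum>d\<leftarrow>xs. d - 1) = 0"
        unfolding defect_eq_0_iff using ns Cons \<open>ns = x # xs\<close> by auto
      moreover have "x \<le> 2" using ns \<open>ns = x # xs\<close> by auto
      ultimately have "(\<Sum>d\<leftarrow>ns. d - 1) \<le> 1"
        unfolding \<open>ns = x # xs\<close> defect_Cons by linarith
      moreover have "ns < [2, 2]"
        using y \<open>x \<le> 2\<close> Cons \<open>ns = x # xs\<close> by (cases "x = 2") auto
      ultimately show ?thesis by (rule small)
    qed
  qed
qed

lemma partition_parts_le_2_defect_2:
  fixes ns :: "nat list"
  assumes ns: "sorted_wrt (\<ge>) ns" "0 \<notin> set ns" "\<forall>d\<in>set ns. d \<le> 2" and defect: "(\<Sum>d\<leftarrow>ns. d - 1) = 2"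
  shows "ns = [2, 2] @ replicate (sum_list ns - 4) 1"
  using ns
proof (cases rule: partition_parts_le_2_cases)
  case (twos zs)
  then have "(\<Sum>d\<leftarrow>zs. d - 1) = 0" using defect by simp
  moreover have "0 \<notin> set zs" using ns(2) twos by simp
  ultimately have "replicate (sum_list zs) 1 = zs" by (intro partition_defect_0)
  then show ?thesis using twos by simp
qed (use defect in simp)

text \<open>A third part equal to 2 would already exceed \<open>(2, 2, 1, \<dots>)\<close> lexicographically.\<close>

lemma partition_parts_le_2_defect_le_2:
  fixes ns :: "nat list"
  assumes ns: "sorted_wrt (\<ge>) ns" "0 \<notin> set ns" "\<forall>d\<in>set ns. d \<le> 2"
    and le: "ns \<le> [2, 2] @ replicate m 1"
  shows "(\<Sum>d\<leftarrow>ns. d - 1) \<le> 2"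
  using ns
proof (cases rule: partition_parts_le_2_cases)
  case (twos zs)
  then have "zs \<le> replicate m 1" using le by simp
  then have "(\<Sum>d\<leftarrow>zs. d - 1) = 0" using ns(1) twos by (intro partition_le_ones) auto
  then show ?thesis using twos by simp
qed simp

lemma partition_parts_le_2_maximal:
  fixes ns :: "nat list"
  assumes ns: "sorted_wrt (\<ge>) ns" "0 \<notin> set ns" "\<forall>d\<in>set ns. d \<le> 2"
    and defect: "(\<Sum>d\<leftarrow>ns. d - 1) \<le> 2"
  shows "ns \<le> [2, 2] @ replicate (sum_list ns - 4) 1"
  using ns
proof (cases rule: partition_parts_le_2_cases)
  case small
  have "[2, 2] \<le> [2, 2] @ replicate (sum_list ns - 4) (1::nat)" by simp
  then show ?thesis using small(2) by (meson less_imp_le order_trans)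
next
  case (twos zs)
  then have "(\<Sum>d\<leftarrow>ns. d - 1) = 2" using defect by simp
  from partition_parts_le_2_defect_2[OF ns this] show ?thesis by (metis order_refl)
qed

lemma partition_part_gt_2_cases:
  fixes ns :: "nat list"
  assumes ns: "sorted_wrt (\<ge>) ns" and big: "d \<in> set ns" "d > 2"
  obtains x xs where "ns = x # xs" "x \<ge> 3"
proof (cases ns)
  case (Cons x xs)
  then have "x \<ge> d" using ns big by auto
  then show ?thesis using that Cons big by simp
qed (use big in simp)

lemma partition_part_gt_2_defect_le_2:
  fixes ns :: "nat list"
  assumes ns: "sorted_wrt (\<ge>) ns" "0 \<notin> set ns" and defect: "(\<Sum>d\<leftarrow>ns. d - 1) \<le> 2"
    and big: "d \<in> set ns" "d > 2"
  shows "ns = [3] @ replicate (sum_list ns - 3) 1"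
proof -
  obtain x xs where ns_eq: "ns = x # xs" "x \<ge> 3" using partition_part_gt_2_cases[OF ns(1) big] .
  then have x: "x = 3" and "(\<Sum>d\<leftarrow>xs. d - 1) = 0"
    using defect unfolding ns_eq(1) defect_Cons by linarith+
  then have "replicate (sum_list xs) 1 = xs" using ns ns_eq by (intro partition_defect_0) auto
  then show ?thesis using ns_eq x by simp
qed

text \<open>The assumption of a part larger than 2 cannot be dropped: \<open>(2, 2, 2)\<close> lies below
\<open>(3, 1, 1, 1)\<close> and has defect 3. This is why the 3-step case of the theorem needs elements
whose adjoint has non-zero square.\<close>

lemma partition_part_gt_2_le_three_ones:
  fixes ns :: "nat list"
  assumes ns: "sorted_wrt (\<ge>) ns" and big: "d \<in> set ns" "d > 2"
    and le: "ns \<le> [3] @ replicate m 1"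
  shows "(\<Sum>d\<leftarrow>ns. d - 1) \<le> 2"
proof -
  obtain x xs where ns_eq: "ns = x # xs" "x \<ge> 3" using partition_part_gt_2_cases[OF ns(1) big] .
  then have "x = 3" "xs \<le> replicate m 1" using le by auto
  moreover from this have "(\<Sum>d\<leftarrow>xs. d - 1) = 0" using ns ns_eq by (intro partition_le_ones) auto
  ultimately show ?thesis using ns_eq by simp
qed

lemma partition_le_three_ones:
  fixes ns :: "nat list"
  assumes ns: "sorted_wrt (\<ge>) ns" "0 \<notin> set ns" and defect: "(\<Sum>d\<leftarrow>ns. d - 1) \<le> 2"
  shows "ns \<le> [3] @ replicate (sum_list ns - 3) 1"
proof (cases "\<exists>d\<in>set ns. d > 2")
  case True
  then show ?thesis using partition_part_gt_2_defect_le_2[OF ns defect] by (metis order_refl)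
next
  case False
  then show ?thesis by (cases ns) auto
qed

section \<open>Independent families, eigenvalues and rank along pencils\<close>

context vector_space begin

text \<open>The linear independence of an indexed family, as opposed to that of its range, also yields
injectivity, and so lets cardinalities of index sets be compared with dimensions.\<close>

lemma independent_family:
  assumes fin: "finite I"
    and triv: "\<And>c. (\<Sum>i\<in>I. c i *s g i) = 0 \<Longrightarrow> \<forall>i\<in>I. c i = 0"
  shows "inj_on g I" and "independent (g ` I)"
proof -
  show inj: "inj_on g I"
  proof (rule inj_onI, rule ccontr)
    fix i j assume ij: "i \<in> I" "j \<in> I" "g i = g j" "i \<noteq> j"
    let ?c = "\<lambda>l. (if l = i then 1 else 0) - (if l = j then 1 else 0)"
    have "(\<Sum>l\<in>I. ?c l *s g l) =
        (\<Sum>l\<in>I. (if l = i then g l else 0)) - (\<Sum>l\<in>I. (if l = j then g l else 0))"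
      unfolding sum_subtractf[symmetric] by (rule sum.cong) (auto simp: scale_left_diff_distrib)
    also have "\<dots> = 0" using ij fin by (simp add: sum.delta)
    finally show False using triv[of ?c] ij by auto
  qed
  show "independent (g ` I)"
  proof (rule independent_if_scalars_zero)
    show "finite (g ` I)" using fin by simp
    fix f x assume s: "(\<Sum>x\<in>g ` I. f x *s x) = 0" and x: "x \<in> g ` I"
    have "(\<Sum>i\<in>I. f (g i) *s g i) = 0"
      using s by (simp add: sum.reindex[OF inj])
    from triv[OF this] x show "f x = 0" by auto
  qed
qed

lemma eigenvectors_independent:
  assumes T: "Vector_Spaces.linear scale scale T" and fin: "finite S"
    and ev: "\<And>l. l \<in> S \<Longrightarrow> e l \<noteq> 0 \<and> T (e l) = l *s e l"
    and sum0: "(\<Sum>l\<in>S. c l *s e l) = 0"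
  shows "\<forall>l\<in>S. c l = 0"
  using fin ev sum0
proof (induction S arbitrary: c rule: finite_induct)
  case (insert m S)
  interpret T: Vector_Spaces.linear scale scale T by (rule T)
  have eq: "c m *s e m + (\<Sum>l\<in>S. c l *s e l) = 0" using insert by simp
  have "T (c m *s e m + (\<Sum>l\<in>S. c l *s e l)) - m *s (c m *s e m + (\<Sum>l\<in>S. c l *s e l)) = 0"
    unfolding eq by (simp add: T.zero)
  moreover have "T (\<Sum>l\<in>S. c l *s e l) = (\<Sum>l\<in>S. (c l * l) *s e l)"
    using insert.prems(1) by (simp add: T.sum T.scale)
  moreover have "T (e m) = m *s e m" using insert.prems(1) by simp
  ultimately have "(\<Sum>l\<in>S. (c l * l) *s e l) - (\<Sum>l\<in>S. (m * c l) *s e l) = 0"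
    by (simp add: T.add T.scale scale_right_distrib scale_sum_right mult.commute)
  moreover have "(\<Sum>l\<in>S. (c l * l) *s e l) - (\<Sum>l\<in>S. (m * c l) *s e l)
      = (\<Sum>l\<in>S. (c l * (l - m)) *s e l)"
    unfolding sum_subtractf[symmetric] scale_left_diff_distrib[symmetric]
    by (simp add: right_diff_distrib mult.commute)
  ultimately have "(\<Sum>l\<in>S. (c l * (l - m)) *s e l) = 0" by simp
  from insert.IH[OF _ this] insert.prems(1) have "\<forall>l\<in>S. c l * (l - m) = 0" by blast
  then have S: "\<forall>l\<in>S. c l = 0" using insert.hyps by auto
  then have "c m *s e m = 0" using eq by simp
  then show ?case using S insert.prems(1) by auto
qed simp

lemma linear_funpow: "Vector_Spaces.linear scale scale f \<Longrightarrow> Vector_Spaces.linear scale scale (f ^^ k)"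
proof (induction k)
  case 0 then show ?case using linear_id by (simp add: id_def)
next
  case (Suc k)
  then show ?case using Vector_Spaces.linear_compose[of scale scale "f ^^ k" scale f] by (simp add: comp_def)
qed

lemma subspace_range_linear: "Vector_Spaces.linear scale scale f \<Longrightarrow> subspace (range f)"
  using subspace_UNIV module_hom.subspace_image module_hom_iff_linear by blast
lemma finite_line_meets_subspace:
  assumes D: "subspace D" and x: "x \<notin> D"
  shows "finite {t. x + t *s y \<in> D}"
proof -
  have unique: "s = t" if s: "x + s *s y \<in> D" and t: "x + t *s y \<in> D" for s t
  proof (rule ccontr)
    assume ne: "s \<noteq> t"
    have "(x + s *s y) - (x + t *s y) \<in> D" using s t by (rule subspace_diff[OF D])
    then have "(s - t) *s y \<in> D" by (simp add: scale_left_diff_distrib)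
    then have "inverse (s - t) *s (s - t) *s y \<in> D" by (rule subspace_scale[OF D])
    then have "y \<in> D" using ne by simp
    then have "x + s *s y - s *s y \<in> D" using s by (intro subspace_diff[OF D] subspace_scale[OF D])
    then show False using x by simp
  qed
  show ?thesis
  proof (cases "\<exists>s. x + s *s y \<in> D")
    case True
    then obtain s where "x + s *s y \<in> D" by blast
    then have "{t. x + t *s y \<in> D} \<subseteq> {s}" using unique by blast
    then show ?thesis by (rule finite_subset) simp
  qed simp
qed

end

context finite_dimensional_vector_space begin

lemma finite_eigenvalues:
  assumes T: "Vector_Spaces.linear scale scale T"
  shows "finite {l. \<exists>v. v \<noteq> 0 \<and> T v = l *s v}" (is "finite ?E")
proof (rule ccontr)
  assume "infinite ?E"
  then obtain S where S: "S \<subseteq> ?E" "finite S" "card S = Suc dimension"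
    using infinite_arbitrarily_large by blast
  then have "\<forall>l\<in>S. \<exists>v. v \<noteq> 0 \<and> T v = l *s v" by auto
  then obtain e where e: "\<And>l. l \<in> S \<Longrightarrow> e l \<noteq> 0 \<and> T (e l) = l *s e l" by metis
  note fam = independent_family[OF S(2) eigenvectors_independent[OF T S(2) e]]
  have "inj_on e S" "independent (e ` S)" using fam by blast+
  then have "card S = dim (e ` S)" by (simp add: dim_eq_card_independent card_image)
  then show False using dim_subset_UNIV[of "e ` S"] S(3) by simp
qed

text \<open>Rank is lower semicontinuous along a pencil. With \<open>g\<close> a right inverse of \<open>B\<close> on its range, a
drop of rank at \<open>t\<close> gives a non-zero \<open>w\<close> in the range of \<open>B\<close> with \<open>A (g w) + t w = 0\<close>, so
\<open>- t\<close> is one of the finitely many eigenvalues of \<open>A \<circ> g\<close>.\<close>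

lemma rank_pencil_ge_cofinite:
  assumes A: "Vector_Spaces.linear scale scale A" and B: "Vector_Spaces.linear scale scale B"
  shows "finite {t. dim (range (\<lambda>v. A v + t *s B v)) < dim (range B)}"
proof -
  interpret pair: finite_dimensional_vector_space_pair scale Basis scale Basis by unfold_locales
  obtain g where g: "Vector_Spaces.linear scale scale g" and Bg: "\<And>v. v \<in> range B \<Longrightarrow> B (g v) = v"
    using pair.linear_exists_right_inverse_on[OF B subspace_UNIV] by blast
  interpret A: Vector_Spaces.linear scale scale A by (rule A)
  interpret B: Vector_Spaces.linear scale scale B by (rule B)
  interpret g: Vector_Spaces.linear scale scale g by (rule g)
  have T: "Vector_Spaces.linear scale scale (A \<circ> g)"
    using Vector_Spaces.linear_compose[OF g A] .
  have "{t. dim (range (\<lambda>v. A v + t *s B v)) < dim (range B)}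
      \<subseteq> uminus ` {l. \<exists>v. v \<noteq> 0 \<and> (A \<circ> g) v = l *s v}"
  proof
    fix t assume t: "t \<in> {t. dim (range (\<lambda>v. A v + t *s B v)) < dim (range B)}"
    let ?h = "\<lambda>w. A (g w) + t *s B (g w)"
    have h: "Vector_Spaces.linear scale scale ?h"
      unfolding Vector_Spaces.linear_iff using vector_space_axioms
      by (auto simp: A.add B.add g.add A.scale B.scale g.scale scale_right_distrib mult.commute)
    have sB: "subspace (range B)" by (rule subspace_range_linear[OF B])
    have "\<not> inj_on ?h (range B)"
    proof
      assume inj: "inj_on ?h (range B)"
      have "span (range B) = range B" using sB by simp
      then have "inj_on ?h (span (range B))" using inj by metis
      then have "dim (?h ` range B) = dim (range B)" by (rule pair.dim_image_eq[OF h])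
      moreover have "dim (?h ` range B) \<le> dim (range (\<lambda>v. A v + t *s B v))"
        by (rule dim_subset) auto
      ultimately show False using t by simp
    qed
    then obtain w where w: "w \<in> range B" "?h w = 0" "w \<noteq> 0"
      using module_hom.inj_on_iff_eq_0[of scale scale ?h "range B"] h sB module_hom_iff_linear by blast
    then have "A (g w) = (- t) *s w" by (simp add: Bg eq_neg_iff_add_eq_0)
    then show "t \<in> uminus ` {l. \<exists>v. v \<noteq> 0 \<and> (A \<circ> g) v = l *s v}"
      using w by (intro image_eqI[of _ _ "- t"]) auto
  qed
  then show ?thesis using finite_subset finite_imageI[OF finite_eigenvalues[OF T]] by blast
qed

end

section \<open>Jordan chains of nilpotent operators\<close>

text \<open>The list runs from the kernel upwards, matching the ones on the superdiagonal of
\<^const>\<open>jordan_block\<close>.\<close>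

definition jordan_chain :: "('b::zero \<Rightarrow> 'b) \<Rightarrow> 'b list \<Rightarrow> bool" where
  "jordan_chain f c \<longleftrightarrow> (\<forall>i<length c. f (c ! i) = (if i = 0 then 0 else c ! (i - 1)))"

definition orbit_family :: "('b \<Rightarrow> 'b) \<Rightarrow> ('b \<Rightarrow> 'b) \<Rightarrow> 'b \<times> nat \<Rightarrow> 'b" where
  "orbit_family f v = (\<lambda>(b, j). (f ^^ j) (v b))"

text \<open>\<open>N\<close> is any exponent that annihilates the operator.\<close>

locale nilpotent_operator = finite_dimensional_vector_space scale Basis
  for scale :: "'a::field \<Rightarrow> 'b::ab_group_add \<Rightarrow> 'b" (infixr \<open>*s\<close> 75) and Basis +
  fixes f :: "'b \<Rightarrow> 'b" and N :: nat
  assumes linear_f: "Vector_Spaces.linear scale scale f" and nil: "(f ^^ N) x = 0"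
begin

text \<open>\<open>Basis\<close> merely serves as a finite index set of the right type. An index with
\<open>d b = 0\<close> contributes nothing.\<close>

definition cyclic_generators :: "('b \<Rightarrow> 'b) \<Rightarrow> ('b \<Rightarrow> nat) \<Rightarrow> bool" where
  "cyclic_generators v d \<longleftrightarrow>
     (\<forall>b\<in>Basis. (f ^^ d b) (v b) = 0) \<and>
     span (orbit_family f v ` (SIGMA b:Basis. {..<d b})) = UNIV"

text \<open>The exchange step of the Jordan decomposition. Let \<open>m\<close> be the lowest power of \<open>f\<close> that occurs in
a linear relation between the orbit vectors, say at index \<open>a\<close>. Dividing the relation formally by
\<open>f ^^ m\<close> gives a vector \<open>w\<close> killed by \<open>f ^^ m\<close>, in which \<open>v a\<close> has an invertible coefficient.
Hence \<open>w\<close> can replace \<open>v a\<close>, and its orbit has length \<open>m < d a\<close>.\<close>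

lemma cyclic_generators_shorten:
  assumes gen: "cyclic_generators v d"
    and rel: "(\<Sum>p\<in>(SIGMA b:Basis. {..<d b}). c p *s orbit_family f v p) = 0"
    and nontriv: "p \<in> (SIGMA b:Basis. {..<d b})" "c p \<noteq> 0"
  shows "\<exists>v' d'. cyclic_generators v' d' \<and> sum d' Basis < sum d Basis"
proof -
  let ?I = "SIGMA b:Basis. {..<d b}"
  interpret f: Vector_Spaces.linear scale scale f by (rule linear_f)
  have flin: "Vector_Spaces.linear scale scale (f ^^ k)" for k by (rule linear_funpow[OF linear_f])
  note fsum = module_hom.sum[OF flin[unfolded module_hom_iff_linear[symmetric]]]
  note fscale = module_hom.scale[OF flin[unfolded module_hom_iff_linear[symmetric]]]
  have fzero: "(f ^^ k) 0 = 0" for k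
    using module_hom.zero[OF flin[unfolded module_hom_iff_linear[symmetric]]] .
  have finI: "finite ?I" using finite_Basis by auto
  have kill: "(f ^^ j) (v b) = 0" if "b \<in> Basis" "d b \<le> j" for b j
  proof -
    have "(f ^^ (j - d b + d b)) (v b) = (f ^^ (j - d b)) ((f ^^ d b) (v b))"
      by (simp only: funpow_add comp_def)
    then show ?thesis using gen that fzero by (simp add: cyclic_generators_def)
  qed
  define m where "m = (LEAST j. \<exists>b. (b, j) \<in> ?I \<and> c (b, j) \<noteq> 0)"
  have "\<exists>j b. (b, j) \<in> ?I \<and> c (b, j) \<noteq> 0" using nontriv by (metis surj_pair)
  then have "\<exists>b. (b, m) \<in> ?I \<and> c (b, m) \<noteq> 0" unfolding m_def by (rule LeastI_ex)
  then obtain a where a: "(a, m) \<in> ?I" "c (a, m) \<noteq> 0" by blast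
  have least: "c (b, j) = 0" if "(b, j) \<in> ?I" "j < m" for b j
    using not_less_Least[of j "\<lambda>j. \<exists>b. (b, j) \<in> ?I \<and> c (b, j) \<noteq> 0"] that
    unfolding m_def[symmetric] by blast
  define w where "w = (\<Sum>(b,j)\<in>?I. c (b, j) *s (f ^^ (j - m)) (v b))"
  have fw: "(f ^^ k) w = (\<Sum>(b,j)\<in>?I. c (b, j) *s (f ^^ (k + (j - m))) (v b))" for k
    unfolding w_def fsum by (rule sum.cong) (auto simp: fscale funpow_add)
  have "(f ^^ m) w = (\<Sum>p\<in>?I. c p *s orbit_family f v p)"
    unfolding fw
  proof (rule sum.cong, simp, clarify)
    fix b j assume bj: "b \<in> Basis" "j < d b"
    show "c (b, j) *s (f ^^ (m + (j - m))) (v b) = c (b, j) *s orbit_family f v (b, j)"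
      using least[of b j] bj by (cases "j < m") (auto simp: orbit_family_def)
  qed
  then have fmw: "(f ^^ m) w = 0" using rel by simp
  define v' where "v' = v(a := w)"
  define d' where "d' = d(a := m)"
  let ?G = "orbit_family f v' ` (SIGMA b:Basis. {..<d' b})"
  have kill': "(f ^^ j) (v' b) \<in> span ?G" if "b \<in> Basis" for b j
  proof (cases "j < d' b")
    case True
    then have "orbit_family f v' (b, j) \<in> ?G" using that by (intro imageI) auto
    then have "orbit_family f v' (b, j) \<in> span ?G" by (rule span_base)
    moreover have "orbit_family f v' (b, j) = (f ^^ j) (v' b)" by (simp add: orbit_family_def)
    ultimately show ?thesis by simp
  next
    case False
    have "(f ^^ d' b) (v' b) = 0"
      using fmw gen that by (auto simp: v'_def d'_def cyclic_generators_def)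
    moreover have "(f ^^ (j - d' b + d' b)) (v' b) = (f ^^ (j - d' b)) ((f ^^ d' b) (v' b))"
      by (simp only: funpow_add comp_def)
    ultimately have "(f ^^ j) (v' b) = 0" using False fzero by simp
    then show ?thesis by (simp add: span_zero)
  qed
  have a_in: "a \<in> Basis" "m < d a" using a by auto
  \<comment> \<open>Downward induction on \<open>j\<close>: modulo higher powers of \<open>f\<close> at \<open>a\<close> and the other orbits, the
    vector \<open>(f ^^ j) (v a)\<close> is a multiple of \<open>(f ^^ j) w\<close>.\<close>
  have va: "\<forall>j. d a \<le> j + r \<longrightarrow> (f ^^ j) (v a) \<in> span ?G" for r
  proof (induction r)
    case 0
    then show ?case using kill[OF a_in(1)] by (auto simp: span_zero)
  next
    case (Suc r)
    show ?case
    proof (intro allI impI)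
      fix j assume j: "d a \<le> j + Suc r"
      let ?h = "\<lambda>(b, l). c (b, l) *s (f ^^ (j + (l - m))) (v b)"
      have rest: "?h p \<in> span ?G" if "p \<in> ?I - {(a, m)}" for p
      proof -
        obtain b l where p: "p = (b, l)" by force
        have "(f ^^ (j + (l - m))) (v b) \<in> span ?G" if "\<not> l < m"
        proof (cases "b = a")
          case True
          then have "m < l" using \<open>p \<in> ?I - {(a, m)}\<close> p that by auto
          then show ?thesis using Suc j True by auto
        next
          case False
          then show ?thesis using kill'[of b] \<open>p \<in> ?I - {(a, m)}\<close> p by (auto simp: v'_def)
        qed
        then show ?thesis
          using least[of b l] that unfolding p
          by (cases "l < m") (auto intro: span_scale simp: span_zero)
      qed
      have "(f ^^ j) w = ?h (a, m) + (\<Sum>p\<in>?I - {(a, m)}. ?h p)"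
        unfolding fw by (rule sum.remove[OF finI a(1)])
      then have "c (a, m) *s (f ^^ j) (v a) = (f ^^ j) w - (\<Sum>p\<in>?I - {(a, m)}. ?h p)"
        by (simp add: algebra_simps)
      moreover have "(f ^^ j) w \<in> span ?G" using kill'[OF a_in(1), of j] by (simp add: v'_def)
      ultimately have "c (a, m) *s (f ^^ j) (v a) \<in> span ?G"
        using rest by (auto intro!: span_diff span_sum)
      then have "inverse (c (a, m)) *s c (a, m) *s (f ^^ j) (v a) \<in> span ?G" by (rule span_scale)
      then show "(f ^^ j) (v a) \<in> span ?G" using a(2) by simp
    qed
  qed
  have "orbit_family f v p \<in> span ?G" if "p \<in> ?I" for p
  proof -
    obtain b j where p: "p = (b, j)" by force
    show ?thesis
    proof (cases "b = a")
      case True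
      then show ?thesis using va[of "d a"] p by (simp add: orbit_family_def)
    next
      case False
      then show ?thesis using kill'[of b j] that p by (auto simp: orbit_family_def v'_def)
    qed
  qed
  then have "span (orbit_family f v ` ?I) \<subseteq> span ?G" by (intro span_minimal) auto
  then have "span ?G = UNIV" using gen by (auto simp: cyclic_generators_def)
  then have "cyclic_generators v' d'"
    using gen fmw by (auto simp: cyclic_generators_def v'_def d'_def)
  moreover have "sum d' Basis < sum d Basis"
    by (rule sum_strict_mono_ex1) (use finite_Basis a_in in \<open>auto simp: d'_def intro!: bexI[of _ a]\<close>)
  ultimately show ?thesis by blast
qed
text \<open>A generating system of minimal total length admits no relation, by the exchange step.\<close>

lemma ex_independent_generators:
  obtains v d where "cyclic_generators v d"
    and "inj_on (orbit_family f v) (SIGMA b:Basis. {..<d b})"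
    and "independent (orbit_family f v ` (SIGMA b:Basis. {..<d b}))"
proof -
  let ?P = "\<lambda>(v, d). cyclic_generators v d"
  have "Basis \<subseteq> orbit_family f id ` (SIGMA b:Basis. {..<Suc N})"
  proof
    fix b assume "b \<in> Basis"
    then show "b \<in> orbit_family f id ` (SIGMA b:Basis. {..<Suc N})"
      by (intro image_eqI[of _ _ "(b, 0)"]) (auto simp: orbit_family_def)
  qed
  then have "span Basis \<subseteq> span (orbit_family f id ` (SIGMA b:Basis. {..<Suc N}))" by (rule span_mono)
  moreover have "f 0 = 0" using module_hom.zero linear_f module_hom_iff_linear by blast
  ultimately have "?P (id, \<lambda>_. Suc N)"
    using span_Basis by (auto simp: cyclic_generators_def nil simp del: id_apply)
  from ex_has_least_nat[of ?P, OF this, of "\<lambda>(v, d). sum d Basis"]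
  obtain v d where gen: "cyclic_generators v d"
    and least: "\<And>v' d'. cyclic_generators v' d' \<Longrightarrow> sum d Basis \<le> sum d' Basis" by auto
  have triv: "\<forall>p\<in>(SIGMA b:Basis. {..<d b}). c p = 0"
    if "(\<Sum>p\<in>(SIGMA b:Basis. {..<d b}). c p *s orbit_family f v p) = 0" for c
    using cyclic_generators_shorten[OF gen that] least by (meson not_le)
  have "finite (SIGMA b:Basis. {..<d b})" using finite_Basis by auto
  from independent_family[OF this triv] gen show ?thesis by (intro that) blast+
qed

lemma ex_jordan_chains:
  obtains css where "\<forall>c\<in>set css. c \<noteq> [] \<and> jordan_chain f c"
    and "sorted_wrt (\<ge>) (map length css)"
    and "distinct (concat css)" "independent (set (concat css))" "span (set (concat css)) = UNIV"
proof -
  obtain v d where gen: "cyclic_generators v d"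
    and inj: "inj_on (orbit_family f v) (SIGMA b:Basis. {..<d b})"
    and indep: "independent (orbit_family f v ` (SIGMA b:Basis. {..<d b}))"
    by (rule ex_independent_generators)
  let ?I = "SIGMA b:Basis. {..<d b}"
  obtain bs where bs: "set bs = Basis" "distinct bs" using finite_distinct_list[OF finite_Basis] by blast
  define ks where "ks = rev (sort_key d (filter (\<lambda>b. 0 < d b) bs))"
  have ks: "set ks = {b \<in> Basis. 0 < d b}" "distinct ks" using bs by (auto simp: ks_def)
  have sorted: "sorted_wrt (\<ge>) (map d ks)"
    unfolding ks_def rev_map[symmetric] sorted_wrt_rev by (simp add: sorted_sort_key)
  let ?chain = "\<lambda>b. map (\<lambda>i. (f ^^ (d b - 1 - i)) (v b)) [0..<d b]"
  define css where "css = map ?chain ks"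
  have set_chain: "set (?chain b) = (\<lambda>j. orbit_family f v (b, j)) ` {..<d b}" for b
  proof -
    have "{0..<d b} = (\<lambda>i. d b - 1 - i) ` {..<d b}"
    proof (rule Set.set_eqI)
      fix i show "i \<in> {0..<d b} \<longleftrightarrow> i \<in> (\<lambda>i. d b - 1 - i) ` {..<d b}"
        by (auto intro!: image_eqI[of _ _ "d b - 1 - i"])
    qed
    then have "(\<lambda>j. (f ^^ (d b - 1 - j)) (v b)) ` {0..<d b}
        = (\<lambda>i. (f ^^ (d b - 1 - (d b - 1 - i))) (v b)) ` {..<d b}"
      by (simp add: image_image)
    also have "\<dots> = (\<lambda>j. orbit_family f v (b, j)) ` {..<d b}"
      by (rule image_cong) (auto simp: orbit_family_def)
    finally show ?thesis by simp
  qed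
  have set_css: "set (concat css) = orbit_family f v ` ?I"
  proof -
    have "set (concat css) = (\<Union>b\<in>set ks. set (?chain b))" by (simp add: css_def)
    also have "\<dots> = (\<Union>b\<in>set ks. (\<lambda>j. orbit_family f v (b, j)) ` {..<d b})"
      by (rule SUP_cong) (simp_all only: set_chain)
    also have "\<dots> = orbit_family f v ` ?I" unfolding ks by force
    finally show ?thesis .
  qed
  have "length (concat css) = sum d Basis"
  proof -
    have "length (concat css) = sum_list (map d ks)" by (simp add: css_def length_concat comp_def)
    also have "\<dots> = sum d (set ks)" using ks(2) by (simp add: sum_list_distinct_conv_sum_set)
    also have "\<dots> = sum d Basis"
      unfolding ks by (rule sum.mono_neutral_left) (use finite_Basis in auto)
    finally show ?thesis .
  qed
  moreover have "card (set (concat css)) = sum d Basis"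
    unfolding set_css card_image[OF inj] using finite_Basis by (simp add: card_SigmaI)
  \<comment> \<open>The list has as many entries as the independent orbit family has indices.\<close>
  ultimately have dist: "distinct (concat css)" by (metis card_distinct)
  have chains: "\<forall>c\<in>set css. c \<noteq> [] \<and> jordan_chain f c"
  proof
    fix c assume "c \<in> set css"
    then obtain b where b: "b \<in> set ks" "c = ?chain b" by (auto simp: css_def)
    then have kb: "b \<in> Basis" "0 < d b" using ks by auto
    have "f (c ! i) = (if i = 0 then 0 else c ! (i - 1))" if "i < d b" for i
    proof -
      have "f (c ! i) = (f ^^ Suc (d b - 1 - i)) (v b)" using that b(2) by simp
      also have "Suc (d b - 1 - i) = d b - i" using that by simp
      finally have fc: "f (c ! i) = (f ^^ (d b - i)) (v b)" .
      show ?thesis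
      proof (cases i)
        case 0
        then show ?thesis using fc gen kb by (simp add: cyclic_generators_def)
      next
        case (Suc k)
        then show ?thesis using fc b(2) that by simp
      qed
    qed
    then show "c \<noteq> [] \<and> jordan_chain f c" using b kb by (auto simp: jordan_chain_def)
  qed
  have "map length css = map d ks" by (simp add: css_def comp_def)
  with sorted have "sorted_wrt (\<ge>) (map length css)" by simp
  then show ?thesis
    using that[OF chains _ dist] indep gen unfolding set_css cyclic_generators_def by blast
qed

end

lemma jordan_chain_funpow:
  assumes chain: "jordan_chain f c" and f0: "f 0 = 0" and i: "i < length c"
  shows "(f ^^ k) (c ! i) = (if i < k then 0 else c ! (i - k))"
proof (induction k)
  case (Suc k)
  have "(f ^^ Suc k) (c ! i) = f (if i < k then 0 else c ! (i - k))" using Suc by simp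
  also have "\<dots> = (if i < Suc k then 0 else c ! (i - Suc k))"
  proof (cases "i < k")
    case False
    then have "f (c ! (i - k)) = (if i - k = 0 then 0 else c ! (i - k - 1))"
      using chain i by (simp add: jordan_chain_def)
    then show ?thesis using False by auto
  qed (use f0 in simp)
  finally show ?case .
qed simp

lemma image_funpow_jordan_chain:
  assumes chain: "jordan_chain f c" and f0: "f 0 = 0"
  shows "(f ^^ k) ` set c \<subseteq> insert 0 (set (take (length c - k) c))"
    and "set (take (length c - k) c) \<subseteq> (f ^^ k) ` set c"
proof -
  note pow = jordan_chain_funpow[OF chain f0]
  show "(f ^^ k) ` set c \<subseteq> insert 0 (set (take (length c - k) c))"
  proof
    fix y assume "y \<in> (f ^^ k) ` set c"
    then obtain i where i: "i < length c" "y = (f ^^ k) (c ! i)" by (auto simp: in_set_conv_nth)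
    show "y \<in> insert 0 (set (take (length c - k) c))"
    proof (cases "i < k")
      case True
      then show ?thesis using i pow by simp
    next
      case False
      then have "y = take (length c - k) c ! (i - k)" "i - k < length (take (length c - k) c)"
        using i pow by auto
      then show ?thesis by (metis insertI2 nth_mem)
    qed
  qed
  show "set (take (length c - k) c) \<subseteq> (f ^^ k) ` set c"
  proof
    fix y assume "y \<in> set (take (length c - k) c)"
    then obtain i where "i < length c - k" "y = c ! i" by (auto simp: in_set_conv_nth)
    then have "y = (f ^^ k) (c ! (i + k))" "i + k < length c" using pow by auto
    then show "y \<in> (f ^^ k) ` set c" by auto
  qed
qed

lemma concat_take_subset: "set (concat (map (\<lambda>c. take (m c) c) css)) \<subseteq> set (concat css)"
  by (induction css) (auto dest: in_set_takeD)

lemma distinct_concat_take: "distinct (concat css) \<Longrightarrow> distinct (concat (map (\<lambda>c. take (m c) c) css))"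
proof (induction css)
  case (Cons c css)
  then show ?case using concat_take_subset[of m css] by (auto dest: in_set_takeD)
qed simp

section \<open>Jordan matrices in terms of chains\<close>

lemma all_less_add_iff: "(\<forall>j<d + m. P j) \<longleftrightarrow> (\<forall>j<d. P j) \<and> (\<forall>l<m. P (d + l))" for d m :: nat
proof safe
  fix j assume a: "\<forall>j<d. P j" "\<forall>l<m. P (d + l)" "j < d + m"
  then show "P j" by (cases "j < d") (metis add_diff_inverse_nat nat_add_left_cancel_less)+
qed auto

lemma sum_lessThan_add: "sum g {..<d + m} = sum g {..<d} + (\<Sum>i<m. g (d + i))"
  for g :: "nat \<Rightarrow> 'b::comm_monoid_add"
  by (induction m) (simp_all add: add.assoc)

lemma ex_concat_of_lengths: "length bs = sum_list ns \<Longrightarrow> \<exists>css. map length css = ns \<and> concat css = bs"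
proof (induction ns arbitrary: bs)
  case Nil
  then show ?case by (intro exI[of _ "[]"]) simp
next
  case (Cons d ns)
  then have "length (drop d bs) = sum_list ns" by simp
  from Cons.IH[OF this] obtain css where "map length css = ns" "concat css = drop d bs" by blast
  then show ?case using Cons.prems by (intro exI[of _ "take d bs # css"]) simp
qed

context lie_algebra begin

lemma is_matrix_of_jordan_block: "is_matrix_of c f (jordan_block (length c) 0) \<longleftrightarrow> jordan_chain f c"
proof -
  have "(\<Sum>i<length c. (jordan_block (length c) 0 $$ (i, j)) *s (c ! i)) = (if j = 0 then 0 else c ! (j - 1))"
    if j: "j < length c" for j
  proof -
    have "(\<Sum>i<length c. (jordan_block (length c) 0 $$ (i, j)) *s (c ! i))
        = (\<Sum>i<length c. if Suc i = j then c ! i else 0)"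
      by (rule sum.cong) (use j in auto)
    also have "\<dots> = (if j = 0 then 0 else c ! (j - 1))"
      using j by (cases j) (simp_all add: sum.delta)
    finally show ?thesis .
  qed
  then show ?thesis unfolding is_matrix_of_def jordan_chain_def by simp
qed

lemma is_matrix_of_append:
  assumes bs: "length bs = sum_list (map fst ms)"
  shows "is_matrix_of (c @ bs) f (jordan_matrix ((length c, 0) # ms)) \<longleftrightarrow>
    is_matrix_of c f (jordan_block (length c) 0) \<and> is_matrix_of bs f (jordan_matrix ms)"
proof -
  let ?d = "length c" and ?m = "length bs" and ?J = "jordan_matrix ms" and ?B = "jordan_block (length c) (0::'k)"
  let ?A = "jordan_matrix ((length c, 0) # ms)"
  have dims: "dim_row ?J = ?m" "dim_col ?J = ?m" using bs by simp_all
  have entry: "?A $$ (i, j) = (if i < ?d then if j < ?d then ?B $$ (i, j) else 0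
      else if j < ?d then 0 else ?J $$ (i - ?d, j - ?d))" if "i < ?d + ?m" "j < ?d + ?m" for i j
    unfolding jordan_matrix_Cons using that dims bs by auto
  have left: "(\<Sum>i<?d + ?m. (?A $$ (i, j)) *s ((c @ bs) ! i)) = (\<Sum>i<?d. (?B $$ (i, j)) *s (c ! i))"
    if j: "j < ?d" for j
  proof -
    have "(\<Sum>i<?d. (?A $$ (i, j)) *s ((c @ bs) ! i)) = (\<Sum>i<?d. (?B $$ (i, j)) *s (c ! i))"
      by (rule sum.cong[OF refl]) (subst entry, use j in \<open>auto simp: nth_append\<close>)
    moreover have "(\<Sum>i<?m. (?A $$ (?d + i, j)) *s ((c @ bs) ! (?d + i))) = 0"
      by (rule sum.neutral, rule ballI) (subst entry, use j in auto)
    ultimately show ?thesis by (simp only: sum_lessThan_add add_0_right)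
  qed
  have right: "(\<Sum>i<?d + ?m. (?A $$ (i, ?d + l)) *s ((c @ bs) ! i)) = (\<Sum>i<?m. (?J $$ (i, l)) *s (bs ! i))"
    if l: "l < ?m" for l
  proof -
    have "(\<Sum>i<?m. (?A $$ (?d + i, ?d + l)) *s ((c @ bs) ! (?d + i))) = (\<Sum>i<?m. (?J $$ (i, l)) *s (bs ! i))"
      by (rule sum.cong[OF refl]) (subst entry, use l in \<open>auto simp: nth_append\<close>)
    moreover have "(\<Sum>i<?d. (?A $$ (i, ?d + l)) *s ((c @ bs) ! i)) = 0"
      by (rule sum.neutral, rule ballI) (subst entry, use l in auto)
    ultimately show ?thesis by (simp only: sum_lessThan_add add_0_left)
  qed
  let ?col = "\<lambda>j. f ((c @ bs) ! j) = (\<Sum>i<?d + ?m. (?A $$ (i, j)) *s ((c @ bs) ! i))"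
  have J_carrier: "?J \<in> carrier_mat ?m ?m" unfolding bs by (rule jordan_matrix_carrier)
  have A_carrier: "?A \<in> carrier_mat (?d + ?m) (?d + ?m)"
    using jordan_matrix_carrier[of "(length c, 0) # ms"] by (simp only: bs list.map fst_conv sum_list.Cons)
  have A: "is_matrix_of (c @ bs) f ?A \<longleftrightarrow> (\<forall>j<?d + ?m. ?col j)"
    and J: "is_matrix_of bs f ?J \<longleftrightarrow> (\<forall>l<?m. f (bs ! l) = (\<Sum>i<?m. (?J $$ (i, l)) *s (bs ! i)))"
    using A_carrier J_carrier by (simp_all only: is_matrix_of_def length_append simp_thms)
  have "(\<forall>j<?d + ?m. ?col j) \<longleftrightarrow> (\<forall>j<?d. ?col j) \<and> (\<forall>l<?m. ?col (?d + l))" by (rule all_less_add_iff)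
  moreover have "(\<forall>j<?d. ?col j) \<longleftrightarrow> is_matrix_of c f ?B"
    using left by (simp add: is_matrix_of_def nth_append)
  moreover have "(\<forall>l<?m. ?col (?d + l)) \<longleftrightarrow> is_matrix_of bs f ?J"
    unfolding J using right by simp
  ultimately show ?thesis using A by blast
qed

lemma is_matrix_of_jordan_matrix:
  "is_matrix_of (concat css) f (jordan_matrix (map (\<lambda>d. (d, 0)) (map length css)))
    \<longleftrightarrow> (\<forall>c\<in>set css. jordan_chain f c)"
proof (induction css)
  case Nil
  then show ?case by (auto simp: is_matrix_of_def jordan_matrix_def)
next
  case (Cons c css)
  have "length (concat css) = sum_list (map fst (map (\<lambda>d. (d, 0 :: 'k)) (map length css)))"
    by (simp add: length_concat comp_def)
  from is_matrix_of_append[OF this, of c f] show ?case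
    by (simp add: Cons[simplified] is_matrix_of_jordan_block)
qed

text \<open>Jordan matrices of a nilpotent operator are traded for chains of vectors, which are easier to
construct and on which powers of the operator act by shifting.\<close>

lemma nilpotent_jordan_sizes_iff:
  "nilpotent_jordan_sizes f ns \<longleftrightarrow> 0 \<notin> set ns \<and>
    (\<exists>css. map length css = ns \<and> ordered_basis (concat css) \<and> (\<forall>c\<in>set css. jordan_chain f c))"
proof -
  have "(\<exists>bs. ordered_basis bs \<and> is_matrix_of bs f (jordan_matrix (map (\<lambda>d. (d, 0)) ns))) \<longleftrightarrow>
    (\<exists>css. map length css = ns \<and> ordered_basis (concat css) \<and> (\<forall>c\<in>set css. jordan_chain f c))"
    (is "?L \<longleftrightarrow> ?R")
  proof
    assume ?L
    then obtain bs where bs: "ordered_basis bs" "is_matrix_of bs f (jordan_matrix (map (\<lambda>d. (d, 0)) ns))"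
      by blast
    then have "dim_row (jordan_matrix (map (\<lambda>d. (d, 0 :: 'k)) ns)) = length bs"
      unfolding is_matrix_of_def by (intro carrier_matD(1)) blast
    then have "length bs = sum_list ns" by (simp add: comp_def)
    then obtain css where css: "map length css = ns" "concat css = bs" using ex_concat_of_lengths by blast
    then show ?R using bs is_matrix_of_jordan_matrix[of css f] by blast
  next
    assume ?R
    then obtain css where css: "map length css = ns" "ordered_basis (concat css)" "\<forall>c\<in>set css. jordan_chain f c"
      by blast
    then show ?L using is_matrix_of_jordan_matrix[of css f] by blast
  qed
  then show ?thesis unfolding nilpotent_jordan_sizes_def by simp
qed

text \<open>The \<open>k\<close>-th power shifts each chain down by \<open>k\<close> places, so its range is spanned by the chains with
their top \<open>k\<close> vectors removed.\<close>

lemma rank_power_jordan_sizes: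
  assumes f: "Vector_Spaces.linear scale scale f" and sizes: "nilpotent_jordan_sizes f ns"
  shows "dim (range (f ^^ k)) = (\<Sum>d\<leftarrow>ns. d - k)"
proof -
  obtain css where css: "map length css = ns" "ordered_basis (concat css)" "\<forall>c\<in>set css. jordan_chain f c"
    using sizes unfolding nilpotent_jordan_sizes_iff by blast
  have f0: "f 0 = 0" using module_hom.zero f module_hom_iff_linear by blast
  let ?ts = "concat (map (\<lambda>c. take (length c - k) c) css)"
  have basis: "distinct (concat css)" "independent (set (concat css))" "span (set (concat css)) = UNIV"
    using css(2) by (auto simp: ordered_basis_def)
  have sub: "(f ^^ k) ` set (concat css) \<subseteq> insert 0 (set ?ts)" "set ?ts \<subseteq> (f ^^ k) ` set (concat css)"
  proof -
    have chain: "(f ^^ k) ` set c \<subseteq> insert 0 (set (take (length c - k) c))"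
      "set (take (length c - k) c) \<subseteq> (f ^^ k) ` set c" if "c \<in> set css" for c
      using image_funpow_jordan_chain[where f = f and c = c and k = k] css(3) f0 that by blast+
    then show "(f ^^ k) ` set (concat css) \<subseteq> insert 0 (set ?ts)" by fastforce
    show "set ?ts \<subseteq> (f ^^ k) ` set (concat css)"
    proof
      fix y assume "y \<in> set ?ts"
      then obtain c where c: "c \<in> set css" "y \<in> set (take (length c - k) c)" by auto
      then have "y \<in> (f ^^ k) ` set c" using chain(2) by blast
      then show "y \<in> (f ^^ k) ` set (concat css)" using c by auto
    qed
  qed
  have "range (f ^^ k) = (f ^^ k) ` span (set (concat css))" using basis by simp
  also have "\<dots> = span ((f ^^ k) ` set (concat css))"
    using module_hom.span_image[of scale scale "f ^^ k"] linear_funpow[OF f] module_hom_iff_linear by metis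
  also have "\<dots> = span (set ?ts)"
    using span_mono[OF sub(1)] span_mono[OF sub(2)] by simp
  finally have "dim (range (f ^^ k)) = dim (set ?ts)" by simp
  also have "\<dots> = card (set ?ts)"
    by (rule dim_eq_card_independent)
       (rule independent_mono[OF basis(2) concat_take_subset])
  also have "\<dots> = length ?ts" by (rule distinct_card[OF distinct_concat_take[OF basis(1)]])
  also have "\<dots> = (\<Sum>d\<leftarrow>map length css. d - k)" by (simp add: length_concat comp_def)
  finally show ?thesis unfolding css(1) .
qed

end

section \<open>Lower central series and Engel identities\<close>

context lie_algebra begin

lemma bracket_zero_left [simp]: "bracket 0 y = 0"
  using bracket_scale_left[of 0 0 y] by simp

lemma bracket_zero_right [simp]: "bracket x 0 = 0"
  using bracket_scale_right[of x 0 0] by simp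

lemma bracket_swap: "bracket x y = - bracket y x"
proof -
  have "bracket (x + y) (x + y) = bracket x x + bracket y x + (bracket x y + bracket y y)"
    by (simp only: bracket_add_left bracket_add_right)
  then have "bracket x y + bracket y x = 0" by (simp add: bracket_self add.commute)
  then show ?thesis by (rule eq_neg_iff_add_eq_0[THEN iffD2])
qed

lemma bracket_minus_left: "bracket (- x) y = - bracket x y"
  using bracket_scale_left[of "-1" x y] by simp

lemma bracket_minus_right: "bracket x (- y) = - bracket x y"
  using bracket_scale_right[of x "-1" y] by simp

lemma bracket_diff_left: "bracket (x - y) z = bracket x z - bracket y z"
  by (simp only: diff_conv_add_uminus bracket_add_left bracket_minus_left)

lemma bracket_diff_right: "bracket x (y - z) = bracket x y - bracket x z"
  by (simp only: diff_conv_add_uminus bracket_add_right bracket_minus_right)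

lemma subspace_scale_cancel:
  assumes "subspace W" "c \<noteq> 0" "c *s v \<in> W" shows "v \<in> W"
  using subspace_scale[OF assms(1,3), of "inverse c"] assms(2) by simp

lemma scale_three: "(3::'k) *s v = v + v + v"
proof -
  have "(3::'k) *s v = (1 + 1 + 1 :: 'k) *s v" by simp
  also have "\<dots> = v + v + v" by (simp only: scale_left_distrib scale_one)
  finally show ?thesis .
qed

lemma linear_ad: "Vector_Spaces.linear scale scale (ad x)"
  unfolding Vector_Spaces.linear_iff using vector_space_axioms
  by (auto simp: ad_def bracket_add_right bracket_scale_right)

lemma subspace_lower_central: "subspace (lower_central k)"
  by (cases k) (simp_all add: bracket_space_def)

lemma bracket_in_lower_central:
  "y \<in> lower_central k \<Longrightarrow> bracket x y \<in> lower_central (Suc k)"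
  unfolding lower_central.simps bracket_space_def by (rule span_base) blast

lemma lower_central_Suc_subset:
  assumes "subspace W" and "\<And>x y. y \<in> lower_central k \<Longrightarrow> bracket x y \<in> W"
  shows "lower_central (Suc k) \<subseteq> W"
  unfolding lower_central.simps bracket_space_def
  by (rule span_minimal) (use assms in auto)

lemma lower_central_decreasing: "lower_central (Suc k) \<subseteq> lower_central k"
proof (induction k)
  case 0 then show ?case by simp
next
  case (Suc k)
  show ?case
    by (rule lower_central_Suc_subset[OF subspace_lower_central])
       (use Suc bracket_in_lower_central in blast)
qed

lemma lower_central_antimono: "j \<le> k \<Longrightarrow> lower_central k \<subseteq> lower_central j"
  by (induction rule: dec_induct) (use lower_central_decreasing in auto)

text \<open>A stationary lower central series stays constant for ever, and nilpotency makes it end in 0.\<close>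

lemma lower_central_trivial_if_stationary:
  assumes nil: "nilpotent" and stat: "lower_central k \<subseteq> lower_central (Suc k)"
  shows "lower_central k = {0}"
proof -
  have *: "lower_central k \<subseteq> lower_central (k + m)" for m
  proof (induction m)
    case (Suc m)
    have "lower_central (Suc k) \<subseteq> lower_central (Suc (k + m))"
      by (rule lower_central_Suc_subset[OF subspace_lower_central])
         (use Suc bracket_in_lower_central in blast)
    then show ?case using stat by simp
  qed simp
  obtain N where "lower_central N = {0}" using nil unfolding nilpotent_def by blast
  then have "lower_central k \<subseteq> {0}"
    using *[of N] lower_central_antimono[of N "k + N"] by auto
  then show ?thesis using subspace_0[OF subspace_lower_central] by blast
qed

lemma ad_power_in_lower_central: "(ad x ^^ k) y \<in> lower_central k"
  by (induction k) (use bracket_in_lower_central in \<open>auto simp: ad_def simp del: lower_central.simps(2)\<close>)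

text \<open>Polarising \<open>[x, [x, y]] \<in> W\<close> shows that modulo \<open>W\<close> the triple product \<open>[x, [y, z]]\<close> changes sign
under each transposition. The three terms of the Jacobi identity are then congruent.\<close>

lemma polarized_engel_identity:
  assumes W: "subspace W" and engel: "\<And>x y. bracket x (bracket x y) \<in> W"
  shows "(3::'k) *s bracket x (bracket y z) \<in> W"
proof -
  have polar: "bracket a (bracket b c) + bracket b (bracket a c) \<in> W" for a b c
  proof -
    have "bracket (a + b) (bracket (a + b) c) - bracket a (bracket a c) - bracket b (bracket b c) \<in> W"
      by (intro subspace_diff[OF W] engel)
    moreover have "bracket (a + b) (bracket (a + b) c) - bracket a (bracket a c) - bracket b (bracket b c)
      = bracket a (bracket b c) + bracket b (bracket a c)"
      by (simp add: bracket_add_left bracket_add_right)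
    ultimately show ?thesis by simp
  qed
  let ?T = "bracket x (bracket y z)"
  have yzx: "bracket y (bracket z x) = - bracket y (bracket x z)"
    by (subst bracket_swap[of z x]) (rule bracket_minus_right)
  have zxy: "bracket x (bracket z y) = - ?T"
    by (subst bracket_swap[of z y]) (rule bracket_minus_right)
  have "(?T + bracket y (bracket x z)) - (bracket z (bracket x y) + bracket x (bracket z y)) \<in> W"
    by (intro subspace_diff[OF W] polar)
  moreover have "(?T + bracket y (bracket x z)) - (bracket z (bracket x y) + bracket x (bracket z y))
    = (?T + ?T + ?T) - (?T + bracket y (bracket z x) + bracket z (bracket x y))"
    unfolding yzx zxy by (simp add: algebra_simps)
  ultimately show ?thesis by (simp add: jacobi scale_three)
qed

text \<open>The map \<open>q t = [x + t z, [x + t z, y]]\<close> is quadratic in \<open>t\<close>, and Lagrange interpolation at 1, -1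
and 2 reads \<open>3 q 0 = 3 q 1 + q (-1) - q 2\<close>. A fixed subspace containing three values thus contains
\<open>3 q 0\<close>, and \<open>q 0\<close> itself as soon as 3 is invertible.\<close>

lemma quadratic_interpolation:
  assumes W: "subspace W"
    and p: "bracket (x + z) (bracket (x + z) y) \<in> W"
    and m: "bracket (x - z) (bracket (x - z) y) \<in> W"
    and d: "bracket (x + (z + z)) (bracket (x + (z + z)) y) \<in> W"
  shows "(3::'k) *s bracket x (bracket x y) \<in> W"
proof -
  let ?q = "\<lambda>u. bracket u (bracket u y)"
  have "(3::'k) *s ?q (x + z) + ?q (x - z) - ?q (x + (z + z)) \<in> W"
    using p m d by (intro subspace_diff[OF W] subspace_add[OF W] subspace_scale[OF W])
  moreover have "(3::'k) *s ?q (x + z) + ?q (x - z) - ?q (x + (z + z)) = (3::'k) *s ?q x"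
    unfolding scale_three
    by (simp add: bracket_add_left bracket_add_right bracket_diff_left bracket_diff_right)
  ultimately show ?thesis by simp
qed
end

locale fin_dim_lie_algebra =
  lie_algebra scale bracket + finite_dimensional_vector_space scale Basis
  for scale :: "'k::field_char_0 \<Rightarrow> 'g::ab_group_add \<Rightarrow> 'g" (infixr \<open>*s\<close> 75)
    and bracket :: "'g \<Rightarrow> 'g \<Rightarrow> 'g" and Basis :: "'g set"
begin

lemma three_cancel: "subspace W \<Longrightarrow> (3::'k) *s v \<in> W \<Longrightarrow> v \<in> W"
  by (rule subspace_scale_cancel[of W 3]) simp_all

text \<open>With \<open>W = {0}\<close>: a 2-Engel Lie algebra in characteristic 0 has class at most 2. The relative
version is applied with \<open>W\<close> a term of the lower central series.\<close>

lemma lower_central_2_subset_if_engel: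
  assumes W: "subspace W" and engel: "\<And>x y. bracket x (bracket x y) \<in> W"
  shows "lower_central 2 \<subseteq> W"
proof -
  have in_W: "bracket x (bracket y z) \<in> W" for x y z
    using three_cancel[OF W polarized_engel_identity[OF W engel]] .
  have lc1: "lower_central 1 \<subseteq> {v. \<forall>x. bracket x v \<in> W}"
    unfolding One_nat_def
    by (rule lower_central_Suc_subset)
       (auto intro!: subspaceI simp: in_W bracket_add_right bracket_scale_right
         subspace_add[OF W] subspace_scale[OF W] subspace_0[OF W])
  show ?thesis unfolding numeral_2_eq_2
    by (rule lower_central_Suc_subset[OF W]) (use lc1 in auto)
qed

text \<open>Write \<open>L\<close> for \<open>lower_central 3\<close> and suppose it is not 0. Then \<open>lower_central 2\<close> is not contained
in \<open>L\<close>, so by the Engel argument some \<open>a\<close> and \<open>y\<close> satisfy \<open>[a, [a, y]] \<notin> L\<close>. For any such \<open>x\<close> in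
place of \<open>a\<close>, the rank bound makes \<open>[x, y]\<close> and \<open>[x, [x, y]]\<close> a basis of the range of \<open>ad x\<close>. A
combination of the two lying in \<open>L\<close> vanishes, as one sees by applying \<open>ad x\<close> once, so the range
of \<open>ad x\<close> meets \<open>L\<close> only in 0. But \<open>ad x\<close> maps \<open>lower_central 2\<close> into \<open>L\<close>, hence annihilates it.
Interpolation provides enough such \<open>x\<close> to conclude that all of the algebra annihilates
\<open>lower_central 2\<close>, that is, \<open>L = 0\<close>.\<close>

lemma lower_central_3_trivial_if_rank_le_2:
  assumes nil: "nilpotent" and rank: "\<And>x. linear_rank (ad x) \<le> 2"
  shows "lower_central 3 = {0}"
proof (rule ccontr)
  assume nontriv: "lower_central 3 \<noteq> {0}"
  let ?L = "lower_central 3"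
  have L: "subspace ?L" by (rule subspace_lower_central)
  have "\<not> lower_central 2 \<subseteq> ?L"
  proof
    assume "lower_central 2 \<subseteq> ?L"
    then have "lower_central 2 = {0}"
      using lower_central_trivial_if_stationary[OF nil, of 2] by simp
    moreover have "?L \<subseteq> lower_central 2" by (rule lower_central_antimono) simp
    ultimately show False using nontriv subspace_0[OF L] by blast
  qed
  then obtain a y where a: "bracket a (bracket a y) \<notin> ?L"
    using lower_central_2_subset_if_engel[OF L] by blast
  have L_ideal: "bracket x v \<in> ?L" if "v \<in> ?L" for x v
    using bracket_in_lower_central[OF that, of x] lower_central_decreasing[of 3] by auto
  have lc2_L: "bracket x v \<in> ?L" if "v \<in> lower_central 2" for x v
    using bracket_in_lower_central[OF that, of x] by (simp add: numeral_3_eq_3 numeral_2_eq_2)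
  have kills: "bracket x u = 0"
    if x: "bracket x (bracket x y) \<notin> ?L" and u: "u \<in> lower_central 2" for x u
  proof -
    let ?p = "bracket x y" and ?q = "bracket x (bracket x y)"
    have "(ad x ^^ 3) y \<in> ?L" by (rule ad_power_in_lower_central)
    then have xq: "bracket x ?q \<in> ?L" by (simp add: ad_def numeral_3_eq_3)
    have comb: "\<alpha> = 0 \<and> \<beta> = 0" if mem: "\<alpha> *s ?p + \<beta> *s ?q \<in> ?L" for \<alpha> \<beta>
    proof -
      have "bracket x (\<alpha> *s ?p + \<beta> *s ?q) - \<beta> *s bracket x ?q \<in> ?L"
        by (intro subspace_diff[OF L] subspace_scale[OF L] L_ideal mem xq)
      then have "\<alpha> *s ?q \<in> ?L" by (simp add: bracket_add_right bracket_scale_right)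
      then have "\<alpha> = 0" using x subspace_scale_cancel[OF L] by blast
      moreover from this mem have "\<beta> = 0"
        using x subspace_scale_cancel[OF L, of \<beta> ?q] by auto
      ultimately show ?thesis by simp
    qed
    have ne: "?p \<noteq> ?q" using comb[of 1 "-1"] subspace_0[OF L] by auto
    have "?q \<noteq> 0" using x subspace_0[OF L] by metis
    then have indep: "independent {?p, ?q}"
      using comb ne subspace_0[OF L]
      by (auto simp: independent_insert span_singleton)
         (metis add.commute add.right_inverse one_neq_zero scale_minus_left scale_one)
    have sub: "{?p, ?q} \<subseteq> range (ad x)" by (auto simp: ad_def)
    have sr: "subspace (range (ad x))"
      using linear_ad[of x] subspace_UNIV module_hom.subspace_image module_hom_iff_linear by blast
    have "card {?p, ?q} = 2" using ne by simp
    then have "dim (range (ad x)) \<le> card {?p, ?q}" using rank[of x] by (simp add: linear_rank_def)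
    then have "range (ad x) \<subseteq> span {?p, ?q}"
      by (rule card_ge_dim_independent[OF sub indep])
    moreover have "bracket x u \<in> range (ad x)" by (auto simp: ad_def)
    ultimately have "bracket x u \<in> span {?p, ?q}" by blast
    then obtain \<alpha> where "bracket x u - \<alpha> *s ?p \<in> span {?q}" by (auto simp: span_breakdown_eq)
    then obtain \<beta> where "bracket x u - \<alpha> *s ?p = \<beta> *s ?q" by (auto simp: span_singleton)
    then have xu: "bracket x u = \<alpha> *s ?p + \<beta> *s ?q" by (simp add: algebra_simps)
    have "\<alpha> = 0 \<and> \<beta> = 0" by (rule comb) (use lc2_L[OF u, of x] xu in simp)
    then show ?thesis using xu by simp
  qed
  \<comment> \<open>One of the three interpolation points \<open>a + z\<close>, \<open>a - z\<close>, \<open>a + 2 z\<close> has the property of \<open>a\<close>, so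
    both it and \<open>a\<close> annihilate \<open>u\<close>.\<close>
  have all: "bracket z u = 0" if u: "u \<in> lower_central 2" for z u
  proof -
    have au: "bracket a u = 0" by (rule kills[OF a u])
    consider "bracket (a + z) (bracket (a + z) y) \<notin> ?L"
      | "bracket (a - z) (bracket (a - z) y) \<notin> ?L"
      | "bracket (a + (z + z)) (bracket (a + (z + z)) y) \<notin> ?L"
      using a three_cancel[OF L quadratic_interpolation[OF L, of a z y]] by blast
    then show ?thesis
    proof cases
      case 1
      from kills[OF 1 u] show ?thesis by (simp add: bracket_add_left au)
    next
      case 2
      from kills[OF 2 u] show ?thesis
        by (simp add: bracket_diff_left au)
    next
      case 3
      from kills[OF 3 u] have "bracket z u + bracket z u = 0" by (simp add: bracket_add_left au)
      then have "(2::'k) *s bracket z u = 0" by (metis one_add_one scale_left_distrib scale_one)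
      then show ?thesis by simp
    qed
  qed
  have "?L \<subseteq> {0}" unfolding numeral_3_eq_3
    by (rule lower_central_Suc_subset) (use all in \<open>auto simp: numeral_2_eq_2\<close>)
  then show False using nontriv subspace_0[OF L] by blast
qed

end

section \<open>Characteristic sequence and breadth as data about ranks\<close>

context fin_dim_lie_algebra begin

text \<open>The definite description in \<^const>\<open>char_seq_of\<close> is meaningful: chains exist because \<open>ad x\<close> is
nilpotent, and the ranks of the powers of \<open>ad x\<close> force the sorted list of sizes.\<close>

lemma char_seq_of_is_jordan_sizes:
  assumes nil: "nilpotent"
  shows "sorted_wrt (\<ge>) (char_seq_of x)" and "nilpotent_jordan_sizes (ad x) (char_seq_of x)"
proof -
  obtain N where N: "lower_central N = {0}" using nil unfolding nilpotent_def by blast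
  interpret ad: nilpotent_operator scale Basis "ad x" N
  proof (intro nilpotent_operator.intro nilpotent_operator_axioms.intro
      finite_dimensional_vector_space_axioms linear_ad)
    show "(ad x ^^ N) y = 0" for y using ad_power_in_lower_central[where k = N] N by auto
  qed
  obtain css where css: "\<forall>c\<in>set css. c \<noteq> [] \<and> jordan_chain (ad x) c"
    "sorted_wrt (\<ge>) (map length css)"
    "distinct (concat css)" "independent (set (concat css))" "span (set (concat css)) = UNIV"
    by (rule ad.ex_jordan_chains)
  let ?P = "\<lambda>ns. sorted_wrt (\<ge>) ns \<and> nilpotent_jordan_sizes (ad x) ns"
  have "?P (map length css)"
    unfolding nilpotent_jordan_sizes_iff ordered_basis_def using css by auto
  moreover have "ns = ms" if "?P ns" "?P ms" for ns ms
  proof (rule partition_eqI)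
    show "0 \<notin> set ns" "0 \<notin> set ms" using that by (auto simp: nilpotent_jordan_sizes_def)
    show "(\<Sum>d\<leftarrow>ns. d - k) = (\<Sum>d\<leftarrow>ms. d - k)" for k
      using that rank_power_jordan_sizes[OF linear_ad, of x _ k] by metis
  qed (use that in auto)
  ultimately have "\<exists>!ns. ?P ns" by blast
  then have "?P (char_seq_of x)" unfolding char_seq_of_def by (rule theI')
  then show "sorted_wrt (\<ge>) (char_seq_of x)" "nilpotent_jordan_sizes (ad x) (char_seq_of x)" by auto
qed

lemma char_seq_of_partition:
  assumes nil: "nilpotent"
  shows "sorted_wrt (\<ge>) (char_seq_of x)" and "0 \<notin> set (char_seq_of x)"
    and "sum_list (char_seq_of x) = dim (UNIV :: 'g set)"
    and "(\<Sum>d\<leftarrow>char_seq_of x. d - 1) = linear_rank (ad x)"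
    and "(\<forall>d\<in>set (char_seq_of x). d \<le> 2) \<longleftrightarrow> (\<forall>y. bracket x (bracket x y) = 0)"
proof -
  note sizes = char_seq_of_is_jordan_sizes[OF nil, of x]
  note rank = rank_power_jordan_sizes[OF linear_ad sizes(2)]
  show "sorted_wrt (\<ge>) (char_seq_of x)" by (rule sizes)
  show "0 \<notin> set (char_seq_of x)" using sizes(2) by (simp add: nilpotent_jordan_sizes_iff)
  show "sum_list (char_seq_of x) = dim (UNIV :: 'g set)" using rank[of 0] by simp
  show "(\<Sum>d\<leftarrow>char_seq_of x. d - 1) = linear_rank (ad x)" using rank[of 1] by (simp add: linear_rank_def)
  have "(\<forall>d\<in>set (char_seq_of x). d \<le> 2) \<longleftrightarrow> (\<Sum>d\<leftarrow>char_seq_of x. d - 2) = 0" by auto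
  also have "\<dots> \<longleftrightarrow> range (ad x ^^ 2) \<subseteq> {0}" unfolding rank[of 2, symmetric] dim_eq_0 by simp
  also have "\<dots> \<longleftrightarrow> (\<forall>y. bracket x (bracket x y) = 0)"
    by (auto simp: ad_def numeral_2_eq_2)
  finally show "(\<forall>d\<in>set (char_seq_of x). d \<le> 2) \<longleftrightarrow> (\<forall>y. bracket x (bracket x y) = 0)" .
qed

lemma finite_range_char_seq_of:
  assumes nil: "nilpotent" shows "finite (range char_seq_of)"
proof -
  let ?n = "dim (UNIV :: 'g set)"
  have len: "length ns \<le> sum_list ns" if "0 \<notin> set ns" for ns :: "nat list"
    using that by (induction ns) auto
  have "range char_seq_of \<subseteq> {ns. set ns \<subseteq> {..?n} \<and> length ns \<le> ?n}"
  proof clarify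
    fix x
    have "d \<le> sum_list (char_seq_of x)" if "d \<in> set (char_seq_of x)" for d
      using that by (intro member_le_sum_list) auto
    then show "set (char_seq_of x) \<subseteq> {..?n} \<and> length (char_seq_of x) \<le> ?n"
      using len[OF char_seq_of_partition(2)[OF nil, of x]]
      unfolding char_seq_of_partition(3)[OF nil] by blast
  qed
  then show ?thesis using finite_lists_length_le[of "{..?n}" ?n] finite_subset by blast
qed

lemma finite_char_seqs: "nilpotent \<Longrightarrow> finite (char_seq_of ` (UNIV - derived_subalgebra))"
  by (rule finite_subset[OF image_mono[OF subset_UNIV] finite_range_char_seq_of])

lemma derived_subalgebra_proper:
  assumes nil: "nilpotent" and "lower_central 0 \<noteq> {0}" shows "derived_subalgebra \<noteq> UNIV"
  using lower_central_trivial_if_stationary[OF nil, of 0] assms(2) by (auto simp: derived_subalgebra_def)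

lemma char_seq_ge:
  assumes "nilpotent" "x \<notin> derived_subalgebra" shows "char_seq_of x \<le> char_seq"
  unfolding char_seq_def
  by (rule Max_ge) (use assms finite_char_seqs[OF assms(1)] in auto)

lemma char_seq_attained:
  assumes "nilpotent" "derived_subalgebra \<noteq> UNIV"
  obtains x where "x \<notin> derived_subalgebra" "char_seq_of x = char_seq"
proof -
  have "char_seq \<in> char_seq_of ` (UNIV - derived_subalgebra)"
    unfolding char_seq_def
    by (rule Max_in) (use assms finite_char_seqs[OF assms(1)] in auto)
  then show ?thesis using that by auto
qed

lemma char_seq_eqI:
  assumes "nilpotent" "x \<notin> derived_subalgebra" "char_seq_of x = ns"
    and "\<And>y. y \<notin> derived_subalgebra \<Longrightarrow> char_seq_of y \<le> ns"
  shows "char_seq = ns"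
  unfolding char_seq_def
  by (rule Max_eqI) (use assms finite_char_seqs[OF assms(1)] in auto)

lemma breadth_eq_2_iff:
  "breadth = 2 \<longleftrightarrow> (\<forall>x. linear_rank (ad x) \<le> 2) \<and> (\<exists>x. linear_rank (ad x) = 2)"
proof -
  let ?R = "range (\<lambda>x. linear_rank (ad x))"
  have fin: "finite ?R"
    by (rule finite_subset[of _ "{..dimension}"]) (auto simp: linear_rank_def dim_subset_UNIV)
  have "breadth = 2 \<longleftrightarrow> 2 \<in> ?R \<and> (\<forall>r\<in>?R. r \<le> 2)"
    unfolding breadth_def by (rule Max_eq_iff) (use fin in auto)
  moreover have "2 \<in> ?R \<longleftrightarrow> (\<exists>x. linear_rank (ad x) = 2)" by (metis rangeE rangeI)
  ultimately show ?thesis by blast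
qed

end

section \<open>Lie algebras of breadth two\<close>

context fin_dim_lie_algebra begin

lemma in_derived_subalgebra: "bracket x y \<in> derived_subalgebra"
  unfolding derived_subalgebra_def bracket_space_def by (rule span_base) blast

lemma step_nilpotent_2_iff: "step_nilpotent 2 \<longleftrightarrow> lower_central 2 = {0} \<and> (\<exists>x y. bracket x y \<noteq> 0)"
proof -
  have "lower_central 1 \<noteq> {0}" if "bracket x y \<noteq> 0" for x y
    using bracket_in_lower_central[of y 0 x] that by auto
  moreover have "lower_central 1 = {0}" if "\<And>x y. bracket x y = 0"
    using lower_central_Suc_subset[of "{0}" 0] subspace_0[OF subspace_lower_central[of 1]] that by auto
  moreover have "lower_central 1 = {0}" if "lower_central 0 = {0}"
  proof -
    have "lower_central 1 \<subseteq> lower_central 0" by (rule lower_central_antimono) simp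
    then show ?thesis using that subspace_0[OF subspace_lower_central[of 1]] by blast
  qed
  ultimately show ?thesis
    unfolding step_nilpotent_def numeral_2_eq_2 less_Suc_eq by (auto simp del: lower_central.simps) 
qed

text \<open>If some \<open>x\<close> outside the derived subalgebra has \<open>(ad x)\<^sup>2 \<noteq> 0\<close>, its partition must be
\<open>(3, 1, \<dots>, 1)\<close>, the largest one of defect at most 2, and the rank bound limits the class to 3.
Otherwise \<open>(ad x)\<^sup>2\<close> vanishes outside the derived subalgebra, hence everywhere by interpolation,
the class is 2, and every element of rank 2 has partition \<open>(2, 2, 1, \<dots>, 1)\<close>.\<close>

lemma breadth_2_imp:
  assumes nil: "nilpotent" and breadth: "breadth = 2"
  shows "(step_nilpotent 2 \<and> char_seq = [2, 2] @ replicate (dim (UNIV :: 'g set) - 4) 1) \<or>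
         (step_nilpotent 3 \<and> char_seq = [3] @ replicate (dim (UNIV :: 'g set) - 3) 1)"
proof -
  let ?n = "dim (UNIV :: 'g set)"
  note part = char_seq_of_partition[OF nil]
  have rank: "linear_rank (ad x) \<le> 2" for x using breadth breadth_eq_2_iff by blast
  obtain b where b: "linear_rank (ad b) = 2" using breadth breadth_eq_2_iff by blast
  have "\<exists>y. bracket b y \<noteq> 0"
  proof (rule ccontr)
    assume "\<not> ?thesis"
    then have "range (ad b) \<subseteq> {0}" by (auto simp: ad_def)
    then have "linear_rank (ad b) = 0" unfolding linear_rank_def dim_eq_0 .
    then show False using b by simp
  qed
  then obtain b' where b': "bracket b b' \<noteq> 0" by blast
  then have "lower_central 0 \<noteq> {0}" by auto
  then obtain z where z: "z \<notin> derived_subalgebra" using derived_subalgebra_proper[OF nil] by blast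
  show ?thesis
  proof (cases "\<exists>x y. x \<notin> derived_subalgebra \<and> bracket x (bracket x y) \<noteq> 0")
    case True
    then obtain x y where x: "x \<notin> derived_subalgebra" "bracket x (bracket x y) \<noteq> 0" by blast
    have "(ad x ^^ 2) y \<in> lower_central 2" by (rule ad_power_in_lower_central)
    then have "lower_central 2 \<noteq> {0}" using x(2) by (auto simp: ad_def numeral_2_eq_2 simp del: lower_central.simps)
    then have "lower_central j \<noteq> {0}" if "j < 3" for j
      using lower_central_antimono[of j 2] that subspace_0[OF subspace_lower_central[of 2]] by fastforce
    then have step: "step_nilpotent 3"
      unfolding step_nilpotent_def using lower_central_3_trivial_if_rank_le_2[OF nil rank] by blast
    have "\<not> (\<forall>d\<in>set (char_seq_of x). d \<le> 2)" using part(5)[of x] x by blast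
    then obtain d where "d \<in> set (char_seq_of x)" "d > 2" by auto
    then have "char_seq_of x = [3] @ replicate (?n - 3) 1"
      using partition_part_gt_2_defect_le_2[OF part(1,2), of x d] part(3,4)[of x] rank[of x] by simp
    moreover have "char_seq_of y \<le> [3] @ replicate (?n - 3) 1" for y
      using partition_le_three_ones[OF part(1,2), of y] part(3,4)[of y] rank[of y] by simp
    ultimately have "char_seq = [3] @ replicate (?n - 3) 1" using char_seq_eqI[OF nil x(1)] by blast
    then show ?thesis using step by blast
  next
    case False
    have D: "subspace derived_subalgebra" by (simp add: derived_subalgebra_def bracket_space_def)
    \<comment> \<open>For \<open>x\<close> in the derived subalgebra, the points \<open>x + z\<close>, \<open>x - z\<close> and \<open>x + 2 z\<close> all lie outside it.\<close>
    have engel: "bracket x (bracket x y) = 0" for x y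
    proof (cases "x \<in> derived_subalgebra")
      case True
      have zz: "z + z \<notin> derived_subalgebra"
      proof
        assume "z + z \<in> derived_subalgebra"
        then have "(2::'k) *s z \<in> derived_subalgebra" by (metis one_add_one scale_left_distrib scale_one)
        then show False using z subspace_scale_cancel[OF D, of 2 z] by simp
      qed
      have "x + z \<notin> derived_subalgebra" "x - z \<notin> derived_subalgebra" "x + (z + z) \<notin> derived_subalgebra"
        using z zz True subspace_diff[OF D, of "x + z" x] subspace_diff[OF D, of x "x - z"]
          subspace_diff[OF D, of "x + (z + z)" x] by auto
      then have "(3::'k) *s bracket x (bracket x y) \<in> {0}"
        using False by (intro quadratic_interpolation[of "{0}" x z y]) auto
      then show ?thesis by simp
    qed (use False in blast)
    have lc2: "lower_central 2 = {0}"
      using lower_central_2_subset_if_engel[of "{0}"] engel subspace_0[OF subspace_lower_central[of 2]] by auto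
    have step: "step_nilpotent 2" unfolding step_nilpotent_2_iff using lc2 b' by blast
    \<comment> \<open>In class 2 the derived subalgebra is central, so no element of it has rank 2.\<close>
    have "b \<notin> derived_subalgebra"
    proof
      assume "b \<in> derived_subalgebra"
      then have "bracket b' b \<in> lower_central 2"
        using bracket_in_lower_central[of b 1 b'] by (simp add: derived_subalgebra_def numeral_2_eq_2)
      then show False using lc2 b' bracket_swap[of b b'] by simp
    qed
    moreover have le2: "\<forall>d\<in>set (char_seq_of y). d \<le> 2" for y using part(5)[of y] engel by blast
    have "char_seq_of b = [2, 2] @ replicate (?n - 4) 1"
      using partition_parts_le_2_defect_2[OF part(1,2) le2, of b] part(3,4)[of b] b by simp
    moreover have "char_seq_of y \<le> [2, 2] @ replicate (?n - 4) 1" for y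
      using partition_parts_le_2_maximal[OF part(1,2) le2, of y] part(3,4)[of y] rank[of y] by simp
    ultimately have "char_seq = [2, 2] @ replicate (?n - 4) 1" using char_seq_eqI[OF nil] by blast
    then show ?thesis using step by blast
  qed
qed

lemma breadth_eq_2I:
  assumes nil: "nilpotent" and nontriv: "lower_central 0 \<noteq> {0}"
    and char_seq: "(\<Sum>d\<leftarrow>char_seq. d - 1) = 2" and rank: "\<And>x. linear_rank (ad x) \<le> 2"
  shows "breadth = 2"
proof -
  obtain x where "char_seq_of x = char_seq"
    using char_seq_attained[OF nil derived_subalgebra_proper[OF nil nontriv]] by blast
  then show ?thesis using char_seq_of_partition(4)[OF nil, of x] char_seq rank by (auto simp: breadth_eq_2_iff)
qed

lemma breadth_2_if_step_2:
  assumes nil: "nilpotent" and step: "step_nilpotent 2" and cs: "char_seq = [2, 2] @ replicate m 1"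
  shows "breadth = 2"
proof (rule breadth_eq_2I[OF nil])
  note part = char_seq_of_partition[OF nil]
  have lc2: "lower_central 2 = {0}" using step by (simp add: step_nilpotent_def)
  show "lower_central 0 \<noteq> {0}" using step unfolding step_nilpotent_def by (metis zero_less_numeral)
  show "(\<Sum>d\<leftarrow>char_seq. d - 1) = 2" unfolding cs by (simp add: sum_list_replicate)
  have derived_central: "bracket x v = 0" if "v \<in> derived_subalgebra" for x v
    using bracket_in_lower_central[of v 1 x] that lc2 by (simp add: derived_subalgebra_def numeral_2_eq_2)
  fix x
  show "linear_rank (ad x) \<le> 2"
  proof (cases "x \<in> derived_subalgebra")
    case True
    have "bracket x y = 0" for y using bracket_swap[of x y] derived_central[OF True, of y] by simp
    then have "range (ad x) \<subseteq> {0}" by (auto simp: ad_def)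
    then have "linear_rank (ad x) = 0" unfolding linear_rank_def dim_eq_0 .
    then show ?thesis by simp
  next
    case False
    have "\<forall>d\<in>set (char_seq_of x). d \<le> 2"
      unfolding part(5) using derived_central in_derived_subalgebra by blast
    moreover have "char_seq_of x \<le> [2, 2] @ replicate m 1" using char_seq_ge[OF nil False] cs by simp
    ultimately show ?thesis
      using partition_parts_le_2_defect_le_2[OF part(1,2)] part(4)[of x] by metis
  qed
qed

text \<open>Maximality of \<open>(3, 1, \<dots>, 1)\<close> bounds the rank of \<open>ad u\<close> only if \<open>u\<close> lies outside the derived
subalgebra and \<open>(ad u)\<^sup>2 \<noteq> 0\<close>. Starting from an \<open>x\<close> that attains the maximum, an element \<open>y\<close> of
larger rank would make \<open>x + s y\<close> violate this bound for suitable \<open>s\<close>: all but finitely many \<open>s\<close>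
preserve the large rank and avoid the derived subalgebra, and among the three values \<open>t\<close>, \<open>- t\<close>,
\<open>2 t\<close> at least one keeps the square non-zero.\<close>

lemma breadth_2_if_step_3:
  assumes nil: "nilpotent" and step: "step_nilpotent 3" and cs: "char_seq = [3] @ replicate m 1"
  shows "breadth = 2"
proof (rule breadth_eq_2I[OF nil])
  note part = char_seq_of_partition[OF nil]
  show nontriv: "lower_central 0 \<noteq> {0}" using step unfolding step_nilpotent_def by (metis zero_less_numeral)
  show "(\<Sum>d\<leftarrow>char_seq. d - 1) = 2" unfolding cs by (simp add: sum_list_replicate)
  obtain x where x: "x \<notin> derived_subalgebra" "char_seq_of x = char_seq"
    using char_seq_attained[OF nil derived_subalgebra_proper[OF nil nontriv]] by blast
  then have "\<not> (\<forall>d\<in>set (char_seq_of x). d \<le> 2)" using cs by simp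
  then obtain v where v: "bracket x (bracket x v) \<noteq> 0" unfolding part(5) by blast
  have D: "subspace derived_subalgebra" by (simp add: derived_subalgebra_def bracket_space_def)
  have big: "linear_rank (ad u) \<le> 2" if "u \<notin> derived_subalgebra" "bracket u (bracket u w) \<noteq> 0" for u w
  proof -
    have "\<not> (\<forall>d\<in>set (char_seq_of u). d \<le> 2)" using that part(5)[of u] by blast
    then obtain d where "d \<in> set (char_seq_of u)" "d > 2" by auto
    moreover have "char_seq_of u \<le> [3] @ replicate m 1" using char_seq_ge[OF nil that(1)] cs by simp
    ultimately show ?thesis
      using partition_part_gt_2_le_three_ones[OF part(1)] part(4)[of u] by metis
  qed
  fix y
  show "linear_rank (ad y) \<le> 2"
  proof (rule ccontr)
    assume contra: "\<not> ?thesis"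
    let ?low = "{t. linear_rank (ad (x + t *s y)) < linear_rank (ad y)}"
    let ?der = "{t. x + t *s y \<in> derived_subalgebra}"
    have "ad (x + t *s y) = (\<lambda>v. ad x v + t *s ad y v)" for t
      by (simp add: ad_def bracket_add_left bracket_scale_left)
    then have low: "finite ?low"
      using rank_pencil_ge_cofinite[OF linear_ad linear_ad, of x y] by (simp add: linear_rank_def)
    have der: "finite ?der" by (rule finite_line_meets_subspace[OF D x(1)])
    define bad where "bad = ?low \<union> ?der"
    have "finite (bad \<union> uminus ` bad \<union> (\<lambda>t. t / 2) ` bad)" 
      unfolding bad_def using low der by (intro finite_UnI finite_imageI)
    from ex_new_if_finite[OF infinite_UNIV_char_0 this]
    obtain t where "t \<notin> bad \<union> uminus ` bad \<union> (\<lambda>t. t / 2) ` bad" ..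
    then have t: "t \<notin> bad" "t \<notin> uminus ` bad" "t \<notin> (\<lambda>t. t / 2) ` bad"
      unfolding Un_iff by blast+
    have good: "bracket (x + s *s y) (bracket (x + s *s y) v) = 0" if s: "s \<notin> bad" for s
    proof (rule ccontr)
      assume "bracket (x + s *s y) (bracket (x + s *s y) v) \<noteq> 0"
      then have "linear_rank (ad (x + s *s y)) \<le> 2" using big s by (simp add: bad_def)
      then show False using s contra by (simp add: bad_def)
    qed
    have minus_t: "- t \<notin> bad"
    proof
      assume "- t \<in> bad"
      then have "- (- t) \<in> uminus ` bad" by (rule imageI)
      then show False using t by simp
    qed
    have double_t: "2 * t \<notin> bad"
    proof
      assume "2 * t \<in> bad"
      then have "(2 * t) / 2 \<in> (\<lambda>t. t / 2) ` bad" by (rule imageI)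
      then show False using t by simp
    qed
    have "(3::'k) *s bracket x (bracket x v) \<in> {0}"
    proof (rule quadratic_interpolation[where z = "t *s y"])
      show "bracket (x - t *s y) (bracket (x - t *s y) v) \<in> {0}" using good[OF minus_t] by simp
      have "(2 * t) *s y = t *s y + t *s y" by (simp only: scale_left_distrib[symmetric] mult_2)
      then show "bracket (x + (t *s y + t *s y)) (bracket (x + (t *s y + t *s y)) v) \<in> {0}"
        using good[OF double_t] by simp
    qed (use good[OF t(1)] in auto)
    then show False using v by simp
  qed
qed

end

theorem proposition5:
  fixes scale :: "'k::field_char_0 \<Rightarrow> 'g::ab_group_add \<Rightarrow> 'g"
    and bracket :: "'g \<Rightarrow> 'g \<Rightarrow> 'g"
    and Basis :: "'g set"
    and n :: nat
  assumes "lie_algebra scale bracket"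
    and "finite_dimensional_vector_space scale Basis"
    and "vector_space.dim scale (UNIV :: 'g set) = n"
    and "lie_algebra.nilpotent scale bracket"
  shows "lie_algebra.breadth scale bracket = 2 \<longleftrightarrow>
    (lie_algebra.step_nilpotent scale bracket 2 \<and>
       lie_algebra.char_seq scale bracket = [2, 2] @ replicate (n - 4) 1) \<or>
    (lie_algebra.step_nilpotent scale bracket 3 \<and>
       lie_algebra.char_seq scale bracket = [3] @ replicate (n - 3) 1)"
proof -
  interpret g: fin_dim_lie_algebra scale bracket Basis
    by (rule fin_dim_lie_algebra.intro) fact+
  show ?thesis
    using g.breadth_2_imp g.breadth_2_if_step_2 g.breadth_2_if_step_3 assms(3,4) by blast
qed

end
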